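(* Let $Q\in\mathbb{R}^{n\times n}$ be orthogonal, i.e. $QQ^T=I$. Then $Q$ has the strong inner product property if and only if $Q^T$ has the strong inner product property.
   Context: All matrices are real; $\circ$ denotes the Hadamard product. A matrix $M\in\mathbb{R}^{m\times n}$ with $m\le n$ has the strong inner product property (SIPP) if $M$ has rank $m$ and $X=O$ is the only symmetric $m\times m$ matrix $X$ with $(XM)\circ M=O$. *)

theory Defs
  imports "HOL-Analysis.Analysis"
begin

definition hadamard :: "real^'n^'m \<Rightarrow> real^'n^'m \<Rightarrow> real^'n^'m" (infixl \<open>\<circ>\<^sub>H\<close> 70)
  where "A \<circ>\<^sub>H B = (\<chi> i j. A $ i $ j * B $ i $ j)"

(* In real^'n^'m the row index is 'm, so M is a CARD('m) by CARD('n) matrix. *)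
definition SIPP :: "real^'n^'m \<Rightarrow> bool"
  where "SIPP M \<longleftrightarrow>
    CARD('m) \<le> CARD('n) \<and>
    rank M = CARD('m) \<and>
    (\<forall>X :: real^'m^'m. transpose X = X \<and> (X ** M) \<circ>\<^sub>H M = 0 \<longrightarrow> X = 0)"

end

theory Submission
  imports Defs
begin

text \<open>Conjugation \<open>X \<mapsto> Q X Q\<^sup>T\<close> preserves symmetry and, since \<open>(Q X Q\<^sup>T) Q = Q X = (X Q\<^sup>T)\<^sup>T\<close>,
  carries solutions of \<open>(X Q\<^sup>T) \<circ> Q\<^sup>T = 0\<close> to solutions of \<open>(Y Q) \<circ> Q = 0\<close>.\<close>

lemma transpose_hadamard: "transpose (A \<circ>\<^sub>H B) = transpose A \<circ>\<^sub>H transpose B"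
  by (simp add: hadamard_def transpose_def vec_eq_iff)

lemma SIPP_transpose_orthogonal:
  fixes Q :: "real^'n^'n"
  assumes Q: "orthogonal_matrix Q" and "SIPP Q"
  shows "SIPP (transpose Q)"
  unfolding SIPP_def
proof (intro conjI allI impI)
  show "rank (transpose Q) = CARD('n)"
    using \<open>SIPP Q\<close> by (simp add: SIPP_def rank_transpose)
next
  fix X :: "real^'n^'n"
  assume X: "transpose X = X \<and> X ** transpose Q \<circ>\<^sub>H transpose Q = 0"
  have QtQ: "transpose Q ** Q = mat 1"
    using Q by (simp add: orthogonal_matrix_def)
  define Y where "Y = Q ** X ** transpose Q"
  have YQ: "Y ** Q = Q ** X"
    by (simp add: Y_def QtQ flip: matrix_mul_assoc)
  have "transpose (X ** transpose Q \<circ>\<^sub>H transpose Q) = 0"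
    using X by (simp add: transpose_def vec_eq_iff)
  then have "Y ** Q \<circ>\<^sub>H Q = 0"
    by (simp add: YQ transpose_hadamard matrix_transpose_mul conjunct1[OF X])
  moreover have "transpose Y = Y"
    using X by (simp add: Y_def matrix_transpose_mul matrix_mul_assoc)
  ultimately have "Y = 0"
    using \<open>SIPP Q\<close> by (simp add: SIPP_def)
  \<comment> \<open>Conjugation by \<open>Q\<close> is undone by \<open>transpose Q\<close>, so the
    vanishing of \<open>Y\<close> passes back to \<open>X\<close>.\<close>
  have "X = transpose Q ** (Y ** Q)"
    by (simp add: YQ QtQ matrix_mul_assoc)
  then show "X = 0"
    by (simp add: \<open>Y = 0\<close>)
qed simp

theorem proposition3p5:
  fixes Q :: "real^'n^'n"
  assumes "Q ** transpose Q = mat 1"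
  shows "SIPP Q \<longleftrightarrow> SIPP (transpose Q)"
proof -
  \<comment> \<open>\<open>orthogonal_matrix\<close> asks for both products to be
    \<open>mat 1\<close>; for a square matrix a right inverse is also a left inverse.\<close>
  have "orthogonal_matrix Q"
    using assms by (simp add: orthogonal_matrix_def matrix_left_right_inverse)
  then show ?thesis
    \<comment> \<open>The converse is the same implication at \<open>transpose Q\<close>, which is
      again orthogonal and whose transpose is \<open>Q\<close>.\<close>
    using SIPP_transpose_orthogonal[of Q] SIPP_transpose_orthogonal[of "transpose Q"]
    by (auto simp: orthogonal_matrix_transpose)
qed

end
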